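(* Consider the one-round offloading model described in the context, with $\lambda>0$, $\mu>0$, $b>0$, $B>0$ and the common SNR distribution fixed, $B_{\rm o}=B-Mb$, integer $M\ge1$ with $Mb<B$, and $U_{\rm max}\in(0,\infty)$. Then the mean total upload time $\mathbb{E}[D]$, as a function of $(M,U_{\rm max})$, satisfies: (i) for fixed $U_{\rm max}$, $\mathbb{E}[D]$ increases with $M$ (over integers $M\ge 1$ with $Mb<B$); and (ii) for fixed $M$ with $\lambda\le M$, $\mathbb{E}[D]$ increases with $U_{\rm max}$.
   Context: One-round offloading model. The total bandwidth $B$ is split as $B=B_{\rm o}+Mb$, where $M$ is the number of random access channels, each of bandwidth $b$, and $B_{\rm o}$ is the bandwidth of the offloading channel. The number $K$ of active devices is Poisson with mean $\lambda$. Active device $k$ has an input size $U_{(k)}$ that is exponentially distributed with density $\mu e^{-\mu u}$, $u\ge 0$, and a signal-to-noise ratio (SNR) $\gamma_{(k)}>0$; the $\gamma_{(k)}$ are identically distributed with $\mathbb{E}[1/\gamma_{(k)}]<\infty$. An active device is called contending if and only if $U_{(k)}\le U_{\rm max}$. Each contending device picks one of the $M$ random access channels uniformly at random, and it succeeds (is an offloading device) if and only if no other contending device picks the same channel; $S$ is the number of offloading devices. The random variables $K$, all input sizes, all SNRs, and all channel choices are mutually independent. For the $m$th offloading device, $m=1,\dots,S$, let $\tilde U_{(m)}$ and $\tilde\gamma_{(m)}$ be its input size and SNR, and let its upload time be $$\tilde T_{(m)}=\frac{\tilde U_{(m)}}{B_{\rm o}\log_2(1+\tilde\gamma_{(m)})}.$$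 The total upload time is $D=\sum_{m=1}^{S}\tilde T_{(m)}$ (with $D=0$ if $S=0$). *)

theory Defs
  imports "HOL-Probability.Probability"
begin

text \<open>
  Random variables are functions of the sample point \<open>\<omega>\<close>. Devices are numbered from 0, so the
  active ones are those with index below \<open>K \<omega>\<close>; the input size \<open>U k\<close>, the signal-to-noise
  ratio \<open>\<gamma> k\<close> and the chosen channel \<open>C k\<close> are available for every index \<open>k\<close>, but only those
  of active devices enter the quantities below.
\<close>

definition contending :: "('a \<Rightarrow> nat) \<Rightarrow> (nat \<Rightarrow> 'a \<Rightarrow> real) \<Rightarrow> real \<Rightarrow> 'a \<Rightarrow> nat set" where
  "contending K U Umax \<omega> = {k. k < K \<omega> \<and> U k \<omega> \<le> Umax}"

definition offloading ::
  "('a \<Rightarrow> nat) \<Rightarrow> (nat \<Rightarrow> 'a \<Rightarrow> real) \<Rightarrow> (nat \<Rightarrow> 'a \<Rightarrow> nat) \<Rightarrow> real \<Rightarrow> 'a \<Rightarrow> nat set" where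
  "offloading K U C Umax \<omega> =
     {k \<in> contending K U Umax \<omega>. \<forall>j \<in> contending K U Umax \<omega>. j \<noteq> k \<longrightarrow> C j \<omega> \<noteq> C k \<omega>}"

definition num_offloading ::
  "('a \<Rightarrow> nat) \<Rightarrow> (nat \<Rightarrow> 'a \<Rightarrow> real) \<Rightarrow> (nat \<Rightarrow> 'a \<Rightarrow> nat) \<Rightarrow> real \<Rightarrow> 'a \<Rightarrow> nat" where
  "num_offloading K U C Umax \<omega> = card (offloading K U C Umax \<omega>)"

text \<open>The offloading devices are enumerated in increasing order of their index, from \<open>m = 0\<close>.\<close>

definition offloading_device ::
  "('a \<Rightarrow> nat) \<Rightarrow> (nat \<Rightarrow> 'a \<Rightarrow> real) \<Rightarrow> (nat \<Rightarrow> 'a \<Rightarrow> nat) \<Rightarrow> real \<Rightarrow> nat \<Rightarrow> 'a \<Rightarrow> nat" where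
  "offloading_device K U C Umax m \<omega> = sorted_list_of_set (offloading K U C Umax \<omega>) ! m"

definition upload_time ::
  "real \<Rightarrow> ('a \<Rightarrow> nat) \<Rightarrow> (nat \<Rightarrow> 'a \<Rightarrow> real) \<Rightarrow> (nat \<Rightarrow> 'a \<Rightarrow> real) \<Rightarrow> (nat \<Rightarrow> 'a \<Rightarrow> nat) \<Rightarrow> real
    \<Rightarrow> nat \<Rightarrow> 'a \<Rightarrow> real" where
  "upload_time Bo K U \<gamma> C Umax m \<omega> =
     (let k = offloading_device K U C Umax m \<omega> in U k \<omega> / (Bo * log 2 (1 + \<gamma> k \<omega>)))"

definition total_upload_time ::
  "real \<Rightarrow> ('a \<Rightarrow> nat) \<Rightarrow> (nat \<Rightarrow> 'a \<Rightarrow> real) \<Rightarrow> (nat \<Rightarrow> 'a \<Rightarrow> real) \<Rightarrow> (nat \<Rightarrow> 'a \<Rightarrow> nat) \<Rightarrow> real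
    \<Rightarrow> 'a \<Rightarrow> real" where
  "total_upload_time Bo K U \<gamma> C Umax \<omega> =
     (\<Sum>m < num_offloading K U C Umax \<omega>. upload_time Bo K U \<gamma> C Umax m \<omega>)"

datatype rv_index = Count | Size nat | Snr nat | Channel nat

text \<open>
  The library's \<open>indep_vars\<close> needs a common value type, so \<open>K\<close> and the channel choices are
  embedded into the reals; this does not change the sigma-algebras they generate.
\<close>

primrec rv_family ::
  "('a \<Rightarrow> nat) \<Rightarrow> (nat \<Rightarrow> 'a \<Rightarrow> real) \<Rightarrow> (nat \<Rightarrow> 'a \<Rightarrow> real) \<Rightarrow> (nat \<Rightarrow> 'a \<Rightarrow> nat)
    \<Rightarrow> rv_index \<Rightarrow> 'a \<Rightarrow> real" where
  "rv_family K U \<gamma> C Count = (\<lambda>\<omega>. real (K \<omega>))"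
| "rv_family K U \<gamma> C (Size k) = U k"
| "rv_family K U \<gamma> C (Snr k) = \<gamma> k"
| "rv_family K U \<gamma> C (Channel k) = (\<lambda>\<omega>. real (C k \<omega>))"

text \<open>\<open>\<Gamma>\<close> is the common distribution of the signal-to-noise ratios.\<close>

locale one_round_model = prob_space P
  for P :: "'a measure" and lam \<mu> :: real and \<Gamma> :: "real measure" and M :: nat
    and K :: "'a \<Rightarrow> nat" and U \<gamma> :: "nat \<Rightarrow> 'a \<Rightarrow> real" and C :: "nat \<Rightarrow> 'a \<Rightarrow> nat" +
  assumes measurable_K: "random_variable (count_space UNIV) K"
    and measurable_C: "\<And>k. random_variable (count_space UNIV) (C k)"
    and K_poisson: "distr P (count_space UNIV) K = measure_pmf (poisson_pmf lam)"
    and U_exponential: "\<And>k. distributed P lborel (U k) (exponential_density \<mu>)"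
    and \<gamma>_distr: "\<And>k. distr P borel (\<gamma> k) = \<Gamma>"
    and \<gamma>_pos: "\<And>k. AE \<omega> in P. 0 < \<gamma> k \<omega>"
    and integrable_inverse_\<gamma>: "\<And>k. integrable P (\<lambda>\<omega>. 1 / \<gamma> k \<omega>)"
    and C_uniform: "\<And>k. distr P (count_space UNIV) (C k) = measure_pmf (pmf_of_set {..<M})"
    and independent: "indep_vars (\<lambda>_. borel) (rv_family K U \<gamma> C) UNIV"

end

theory Submission
  imports Defs
begin


text \<open>
  Conditioning on \<open>K = n\<close>, on an active device \<open>k\<close> and on its channel \<open>c\<close>, the upload time of
  \<open>k\<close> is a product of independent factors, one per device, in which each of the \<open>n - 1\<close> others
  avoids a collision with probability \<open>1 - q u / M\<close>, where \<open>q u = 1 - exp (- \<mu> * u)\<close> is the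
  probability of contending and \<open>u\<close> stands for \<open>Umax\<close>. Summing over the Poisson distribution gives
  \<open>E D = \<lambda> * exp (- \<lambda> * q u / M) * A u * G / (B - M * b)\<close>, where \<open>A u\<close> is the mean input size
  truncated at \<open>u\<close> and \<open>G = E (1 / log 2 (1 + \<gamma>))\<close>. This visibly increases with \<open>M\<close>. As
  \<open>A' u = u * q' u\<close>, its derivative in \<open>u\<close> has the sign of \<open>u - (\<lambda> / M) * A u\<close>, which is
  positive for \<open>\<lambda> \<le> M\<close> because \<open>A u < u\<close>.
\<close>

section \<open>Elementary bounds, finite sums and a Poisson series\<close>

text \<open>Putting \<open>1 / (1 + x)\<close> into \<open>ln y \<le> y - 1\<close> yields
  \<open>ln (1 + x) \<ge> x / (1 + x)\<close>, and inversion gives the upper bound. It reduces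
  integrability of the inverse upload rate to that of \<open>1 / \<gamma>\<close>.\<close>

lemma inverse_log2_bounds:
  fixes x :: real
  assumes "0 < x"
  shows "0 < 1 / log 2 (1 + x)" and "1 / log 2 (1 + x) \<le> ln 2 * (1 + 1 / x)"
proof -
  have "- ln (1 + x) = ln (1 / (1 + x))"
    using assms by (simp add: ln_div)
  also have "\<dots> \<le> 1 / (1 + x) - 1"
    using assms by (intro ln_le_minus_one) simp
  finally have "x / (1 + x) \<le> ln (1 + x)"
    using assms by (simp add: field_simps)
  then have "1 / ln (1 + x) \<le> 1 / (x / (1 + x))"
    using assms by (intro divide_left_mono mult_pos_pos) auto
  also have "\<dots> = 1 + 1 / x"
    using assms by (simp add: field_simps)
  finally show "1 / log 2 (1 + x) \<le> ln 2 * (1 + 1 / x)"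
    by (simp add: log_def mult_left_mono[of "1 / ln (1 + x)" _ "ln 2", simplified])
  show "0 < 1 / log 2 (1 + x)"
    using assms by simp
qed

text \<open>Frees sums over the offloading devices from the order in which these are
  enumerated.\<close>

lemma sum_nth_sorted_list_of_set:
  assumes "finite A"
  shows "(\<Sum>m < card A. f (sorted_list_of_set A ! m)) = sum f A"
  using sum.reindex_bij_betw[OF bij_betw_nth[of "sorted_list_of_set A" "{..<card A}" A], of f] assms
  by simp

text \<open>The term at \<open>n = 0\<close> vanishes, and cancelling \<open>n\<close> against
  \<open>fact n\<close> followed by an index shift leaves the exponential series of
  \<open>l * r\<close>. In the application \<open>n\<close> counts the choices of the uploading
  device and \<open>r\<close> is the probability that one other device does not collide with
  it.\<close>

lemma sums_poisson_size_biased: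
  fixes l r :: real
  shows "(\<lambda>n. l ^ n / fact n * exp (- l) * (real n * r ^ (n - 1))) sums (l * exp (- l * (1 - r)))"
proof -
  have "(\<lambda>n. (l * r) ^ n / fact n) sums exp (l * r)"
    using exp_converges[of "l * r"] by (simp add: divide_inverse mult.commute scaleR_conv_of_real)
  then have *: "(\<lambda>n. l * exp (- l) * ((l * r) ^ n / fact n)) sums (l * exp (- l) * exp (l * r))"
    by (rule sums_mult)
  have shift: "l * exp (- l) * ((l * r) ^ n / fact n)
      = l ^ Suc n / fact (Suc n) * exp (- l) * (real (Suc n) * r ^ (Suc n - 1))" for n
    by (simp add: field_simps power_mult_distrib del: of_nat_Suc)
  have limit: "l * exp (- l) * exp (l * r) = l * exp (- l * (1 - r))"
    by (simp add: exp_add[symmetric] algebra_simps)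
  have "(\<lambda>n. l ^ Suc n / fact (Suc n) * exp (- l) * (real (Suc n) * r ^ (Suc n - 1)))
      sums (l * exp (- l * (1 - r)))"
    using * unfolding shift limit .
  then show ?thesis
    by (subst (asm) sums_Suc_iff) simp
qed

section \<open>Mean input size truncated at the threshold\<close>

text \<open>Closed form of the integral of \<open>x * (\<mu> * exp (- \<mu> * x))\<close> over
  \<open>{0..u}\<close>: sizes above \<open>u\<close> count as 0, and there is no conditioning on
  the size being at most \<open>u\<close>.\<close>

definition truncated_mean :: "real \<Rightarrow> real \<Rightarrow> real" where
  "truncated_mean \<mu> u = (1 - exp (- \<mu> * u)) / \<mu> - u * exp (- \<mu> * u)"

lemma DERIV_truncated_mean:
  assumes "0 < \<mu>"
  shows "DERIV (truncated_mean \<mu>) u :> u * (\<mu> * exp (- \<mu> * u))"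
  unfolding truncated_mean_def[abs_def] using assms
  by (auto intro!: derivative_eq_intros simp: field_simps)

lemma truncated_mean_pos:
  assumes "0 < \<mu>" "0 < u"
  shows "0 < truncated_mean \<mu> u"
proof -
  have "truncated_mean \<mu> 0 < truncated_mean \<mu> u"
  \<comment> \<open>The derivative vanishes at 0, so its positivity is used only inside the
    interval, together with continuity up to the ends.\<close>
  proof (rule DERIV_pos_imp_increasing_open[OF assms(2)])
    show "\<exists>y. DERIV (truncated_mean \<mu>) x :> y \<and> 0 < y" if "0 < x" "x < u" for x
      using DERIV_truncated_mean[OF assms(1), of x] assms that
      by (intro exI[of _ "x * (\<mu> * exp (- \<mu> * x))"] conjI) auto
    show "continuous_on {0..u} (truncated_mean \<mu>)"
      using DERIV_truncated_mean[OF assms(1)] DERIV_isCont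
      by (blast intro!: continuous_at_imp_continuous_on)
  qed
  then show ?thesis by (simp add: truncated_mean_def)
qed

text \<open>The bound \<open>1 - exp (- t) \<le> t\<close> at \<open>t = \<mu> * u\<close> already
  puts the first summand below \<open>u\<close>; the subtracted term makes the inequality
  strict.\<close>

lemma truncated_mean_less:
  assumes "0 < \<mu>" "0 < u"
  shows "truncated_mean \<mu> u < u"
proof -
  have "1 - exp (- \<mu> * u) \<le> \<mu> * u"
    using exp_ge_add_one_self[of "- \<mu> * u"] by simp
  then have "(1 - exp (- \<mu> * u)) / \<mu> \<le> u"
    using assms by (simp add: field_simps)
  moreover have "0 < u * exp (- \<mu> * u)" using assms by simp
  ultimately show ?thesis unfolding truncated_mean_def by linarith
qed

text \<open>For \<open>c = lam / M\<close> the two sides are, up to factors independent of the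
  threshold, the mean total upload times at \<open>u\<close> and \<open>v\<close>. The derivative is
  a positive factor times \<open>x - c * truncated_mean \<mu> x\<close>.\<close>

lemma truncated_mean_times_exp_less:
  assumes "0 < \<mu>" "0 \<le> c" "c \<le> 1" "0 < u" "u < v"
  shows "truncated_mean \<mu> u * exp (- c * (1 - exp (- \<mu> * u)))
       < truncated_mean \<mu> v * exp (- c * (1 - exp (- \<mu> * v)))"
proof (rule DERIV_pos_imp_increasing[OF assms(5)])
  fix x assume "u \<le> x" "x \<le> v"
  then have x: "0 < x" using assms by simp
  have "c * truncated_mean \<mu> x \<le> truncated_mean \<mu> x"
    using truncated_mean_pos[OF assms(1) x] assms by (simp add: mult_left_le_one_le)
  then have "0 < x - c * truncated_mean \<mu> x"
    using truncated_mean_less[OF assms(1) x] by linarith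
  then have "0 < \<mu> * exp (- \<mu> * x) * exp (- c * (1 - exp (- \<mu> * x))) * (x - c * truncated_mean \<mu> x)"
    using assms by simp
  moreover have "DERIV (\<lambda>x. truncated_mean \<mu> x * exp (- c * (1 - exp (- \<mu> * x)))) x :>
      \<mu> * exp (- \<mu> * x) * exp (- c * (1 - exp (- \<mu> * x))) * (x - c * truncated_mean \<mu> x)"
    by (rule derivative_eq_intros DERIV_truncated_mean assms refl)+ (simp add: algebra_simps)
  ultimately show "\<exists>y. DERIV (\<lambda>x. truncated_mean \<mu> x * exp (- c * (1 - exp (- \<mu> * x)))) x :> y \<and> 0 < y"
    by blast
qed

lemma ennreal_mult3:
  assumes "0 \<le> x" "0 \<le> y"
  shows "ennreal x * ennreal y * ennreal z = ennreal (x * y * z)"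
  using assms by (simp add: ennreal_mult')

section \<open>Factorisation of integrals by independence\<close>

context one_round_model
begin

lemma measurable_rv_family [measurable]: "rv_family K U \<gamma> C i \<in> borel_measurable P"
  using independent by (simp add: indep_vars_def)

lemma measurable_U [measurable]: "U k \<in> borel_measurable P"
  using measurable_rv_family[of "Size k"] by simp

lemma measurable_\<gamma> [measurable]: "\<gamma> k \<in> borel_measurable P"
  using measurable_rv_family[of "Snr k"] by simp

declare measurable_K [measurable] measurable_C [measurable]

text \<open>Functions of disjoint blocks of an independent family are independent. Keeping the three
  variables of a device in one block admits factors \<open>h j\<close> that are not products
  themselves, such as the indicator that a collision is avoided.\<close>

lemma nn_integral_prod_devices:
  fixes g :: "real \<Rightarrow> ennreal" and h :: "nat \<Rightarrow> real \<Rightarrow> real \<Rightarrow> real \<Rightarrow> ennreal"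
  assumes [measurable]: "g \<in> borel_measurable borel"
    and [measurable]: "\<And>j. (\<lambda>(x, y, z). h j x y z) \<in> borel_measurable (borel \<Otimes>\<^sub>M borel \<Otimes>\<^sub>M borel)"
  shows "(\<integral>\<^sup>+\<omega>. g (real (K \<omega>)) * (\<Prod>j<n. h j (U j \<omega>) (\<gamma> j \<omega>) (real (C j \<omega>))) \<partial>P) =
    (\<integral>\<^sup>+\<omega>. g (real (K \<omega>)) \<partial>P) * (\<Prod>j<n. \<integral>\<^sup>+\<omega>. h j (U j \<omega>) (\<gamma> j \<omega>) (real (C j \<omega>)) \<partial>P)"
proof -
  \<comment> \<open>Block 0 is \<open>K\<close> and block \<open>j + 1\<close> is device
    \<open>j\<close>, hence \<open>Suc n\<close> blocks in total.\<close>
  define I where "I = case_nat {Count} (\<lambda>j. {Size j, Snr j, Channel j})"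
  define Y :: "nat \<Rightarrow> (rv_index \<Rightarrow> real) \<Rightarrow> ennreal" where
    "Y = case_nat (\<lambda>f. g (f Count)) (\<lambda>j f. h j (f (Size j)) (f (Snr j)) (f (Channel j)))"
  define Z where "Z i \<omega> = Y i (restrict (\<lambda>r. rv_family K U \<gamma> C r \<omega>) (I i))" for i \<omega>
  have "indep_vars (\<lambda>i. PiM (I i) (\<lambda>_. borel)) (\<lambda>i \<omega>. restrict (\<lambda>r. rv_family K U \<gamma> C r \<omega>) (I i)) {..<Suc n}"
    by (rule indep_vars_restrict[OF independent])
      (auto simp: disjoint_family_on_def I_def split: nat.splits)
  then have "indep_vars (\<lambda>_. borel) Z {..<Suc n}"
    unfolding Z_def
  proof (rule indep_vars_compose2)
    fix i
    show "Y i \<in> borel_measurable (PiM (I i) (\<lambda>_. borel))"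
    proof (cases i)
      case 0
      then show ?thesis by (simp add: Y_def I_def)
    next
      case (Suc j)
      have "(\<lambda>f. (\<lambda>(x, y, z). h j x y z) (f (Size j), f (Snr j), f (Channel j)))
          \<in> borel_measurable (PiM {Size j, Snr j, Channel j} (\<lambda>_. borel))"
        by measurable
      then show ?thesis by (simp add: Y_def I_def Suc)
    qed
  qed
  then have "(\<integral>\<^sup>+\<omega>. (\<Prod>i<Suc n. Z i \<omega>) \<partial>P) = (\<Prod>i<Suc n. \<integral>\<^sup>+\<omega>. Z i \<omega> \<partial>P)"
    by (intro indep_vars_nn_integral) auto
  then show ?thesis
    unfolding prod.lessThan_Suc_shift Z_def Y_def I_def by simp
qed

lemma nn_integral_device:
  fixes f g h :: "real \<Rightarrow> ennreal"
  assumes [measurable]: "f \<in> borel_measurable borel" "g \<in> borel_measurable borel" "h \<in> borel_measurable borel"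
  shows "(\<integral>\<^sup>+\<omega>. f (U k \<omega>) * g (\<gamma> k \<omega>) * h (real (C k \<omega>)) \<partial>P) =
    (\<integral>\<^sup>+\<omega>. f (U k \<omega>) \<partial>P) * (\<integral>\<^sup>+\<omega>. g (\<gamma> k \<omega>) \<partial>P) * (\<integral>\<^sup>+\<omega>. h (real (C k \<omega>)) \<partial>P)"
proof -
  \<comment> \<open>The last branch is meant for \<open>Channel k\<close>; \<open>Count\<close> does
    not lie in \<open>?I\<close>.\<close>
  define Y :: "rv_index \<Rightarrow> real \<Rightarrow> ennreal" where
    "Y i = (case i of Size _ \<Rightarrow> f | Snr _ \<Rightarrow> g | _ \<Rightarrow> h)" for i
  let ?I = "{Size k, Snr k, Channel k}"
  have "indep_vars (\<lambda>_. borel) (\<lambda>i \<omega>. Y i (rv_family K U \<gamma> C i \<omega>)) ?I"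
    by (rule indep_vars_compose2[OF indep_vars_subset[OF independent subset_UNIV]])
      (auto simp: Y_def)
  then have "(\<integral>\<^sup>+\<omega>. (\<Prod>i\<in>?I. Y i (rv_family K U \<gamma> C i \<omega>)) \<partial>P)
      = (\<Prod>i\<in>?I. \<integral>\<^sup>+\<omega>. Y i (rv_family K U \<gamma> C i \<omega>) \<partial>P)"
    by (intro indep_vars_nn_integral) auto
  then show ?thesis
    by (simp add: Y_def mult.assoc)
qed

section \<open>Integrals of the single random variables\<close>

lemma nn_integral_indicator_K:
  assumes "0 < lam"
  shows "(\<integral>\<^sup>+\<omega>. indicator {real n} (real (K \<omega>)) \<partial>P) = ennreal (lam ^ n / fact n * exp (- lam))"
proof -
  have "(\<integral>\<^sup>+\<omega>. indicator {real n} (real (K \<omega>)) \<partial>P)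
      = (\<integral>\<^sup>+k. indicator {n} k \<partial>distr P (count_space UNIV) K)"
    by (subst nn_integral_distr) (auto intro!: nn_integral_cong split: split_indicator)
  also have "\<dots> = ennreal (pmf (poisson_pmf lam) n)"
    by (simp add: K_poisson emeasure_pmf_single)
  finally show ?thesis using assms by simp
qed

lemma nn_integral_indicator_C:
  assumes "c < M"
  shows "(\<integral>\<^sup>+\<omega>. indicator {real c} (real (C k \<omega>)) \<partial>P) = ennreal (1 / real M)"
proof -
  have "(\<integral>\<^sup>+\<omega>. indicator {real c} (real (C k \<omega>)) \<partial>P)
      = (\<integral>\<^sup>+x. indicator {c} x \<partial>distr P (count_space UNIV) (C k))"
    by (subst nn_integral_distr) (auto intro!: nn_integral_cong split: split_indicator)
  also have "\<dots> = ennreal (pmf (pmf_of_set {..<M}) c)"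
    by (simp add: C_uniform emeasure_pmf_single)
  finally show ?thesis using assms by (subst (asm) pmf_of_set) auto
qed

lemma AE_C_less:
  assumes "1 \<le> M"
  shows "AE \<omega> in P. C k \<omega> < M"
proof -
  have "AE x in distr P (count_space UNIV) (C k). x < M"
    unfolding C_uniform using assms by (simp add: AE_measure_pmf_iff lessThan_empty_iff)
  then show ?thesis by (subst (asm) AE_distr_iff) auto
qed

lemma AE_U_nonneg: "AE \<omega> in P. 0 \<le> U k \<omega>"
proof -
  have "AE x in lborel. 0 < ennreal (exponential_density \<mu> x) \<longrightarrow> 0 \<le> x"
    by (rule AE_I2) (auto simp: exponential_density_def)
  then show ?thesis
    by (subst distributed_AE2[OF U_exponential]) simp
qed

lemma nn_integral_U_le:
  assumes "0 < \<mu>" "0 \<le> u"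
  shows "(\<integral>\<^sup>+\<omega>. indicator {..u} (U k \<omega>) \<partial>P) = ennreal (1 - exp (- \<mu> * u))"
proof -
  have "(\<integral>\<^sup>+\<omega>. indicator {..u} (U k \<omega>) \<partial>P) = (\<integral>\<^sup>+\<omega>. indicator {\<omega>\<in>space P. U k \<omega> \<le> u} \<omega> \<partial>P)"
    by (intro nn_integral_cong) (auto split: split_indicator)
  also have "\<dots> = emeasure P {\<omega>\<in>space P. U k \<omega> \<le> u}"
    by (intro nn_integral_indicator) measurable
  finally show ?thesis
    using exponential_distributedD_le[OF U_exponential assms(2,1), of k]
    by (simp add: emeasure_eq_measure mult.commute)
qed

lemma nn_integral_truncated_U:
  assumes "0 < \<mu>" "0 \<le> u"
  shows "(\<integral>\<^sup>+\<omega>. ennreal (U k \<omega>) * indicator {..u} (U k \<omega>) \<partial>P) = ennreal (truncated_mean \<mu> u)"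
proof -
  have "(\<integral>\<^sup>+\<omega>. ennreal (U k \<omega>) * indicator {..u} (U k \<omega>) \<partial>P)
      = (\<integral>\<^sup>+x. ennreal (exponential_density \<mu> x) * (ennreal x * indicator {..u} x) \<partial>lborel)"
    by (rule distributed_nn_integral[OF U_exponential, symmetric]) measurable
  \<comment> \<open>The density vanishes on the negative axis, so only \<open>{0..u}\<close>
    contributes.\<close>
  also have "\<dots> = (\<integral>\<^sup>+x. ennreal (x * (\<mu> * exp (- \<mu> * x))) * indicator {0..u} x \<partial>lborel)"
    using assms
    by (intro nn_integral_cong)
      (auto simp: exponential_density_def ennreal_mult'[symmetric] mult_ac split: split_indicator)
  also have "\<dots> = truncated_mean \<mu> u - truncated_mean \<mu> 0"
    using assms by (intro nn_integral_FTC_Icc DERIV_truncated_mean) auto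
  finally show ?thesis by (simp add: truncated_mean_def)
qed

lemma integrable_inverse_log2_SNR: "integrable P (\<lambda>\<omega>. 1 / log 2 (1 + \<gamma> k \<omega>))"
proof (rule Bochner_Integration.integrable_bound)
  show "integrable P (\<lambda>\<omega>. ln 2 * (1 + 1 / \<gamma> k \<omega>))"
    using integrable_inverse_\<gamma>[of k] by simp
  show "AE \<omega> in P. norm (1 / log 2 (1 + \<gamma> k \<omega>)) \<le> norm (ln 2 * (1 + 1 / \<gamma> k \<omega>))"
    using \<gamma>_pos[of k]
  proof eventually_elim
    fix \<omega> assume "0 < \<gamma> k \<omega>"
    from inverse_log2_bounds[OF this] show "norm (1 / log 2 (1 + \<gamma> k \<omega>)) \<le> norm (ln 2 * (1 + 1 / \<gamma> k \<omega>))"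
      by simp
  qed
qed measurable

text \<open>Expressed through \<open>\<Gamma>\<close>, the mean is one constant for all devices and,
  in the theorem, for all the probability spaces that are compared.\<close>

lemma expectation_inverse_log2_SNR:
  "expectation (\<lambda>\<omega>. 1 / log 2 (1 + \<gamma> k \<omega>)) = (\<integral>x. 1 / log 2 (1 + x) \<partial>\<Gamma>)"
  unfolding \<gamma>_distr[of k, symmetric] by (subst integral_distr) auto

lemma expectation_inverse_log2_SNR_pos: "0 < (\<integral>x. 1 / log 2 (1 + x) \<partial>\<Gamma>)"
proof -
  have "expectation (\<lambda>\<omega>. 0) < expectation (\<lambda>\<omega>. 1 / log 2 (1 + \<gamma> 0 \<omega>))"
    using \<gamma>_pos[of 0]
    by (intro integral_less_AE_space integrable_inverse_log2_SNR)
      (auto elim!: eventually_mono intro: inverse_log2_bounds simp: emeasure_space_1)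
  then show ?thesis by (simp add: expectation_inverse_log2_SNR)
qed

lemma nn_integral_inverse_rate:
  assumes "0 < Bo"
  shows "(\<integral>\<^sup>+\<omega>. ennreal (1 / (Bo * log 2 (1 + \<gamma> k \<omega>))) \<partial>P) = ennreal ((\<integral>x. 1 / log 2 (1 + x) \<partial>\<Gamma>) / Bo)"
proof -
  have "(\<integral>\<^sup>+\<omega>. ennreal (1 / (Bo * log 2 (1 + \<gamma> k \<omega>))) \<partial>P) = (\<integral>\<^sup>+\<omega>. ennreal (1 / log 2 (1 + \<gamma> k \<omega>) / Bo) \<partial>P)"
    by (simp add: mult.commute)
  also have "\<dots> = ennreal (expectation (\<lambda>\<omega>. 1 / log 2 (1 + \<gamma> k \<omega>) / Bo))"
    using assms \<gamma>_pos[of k]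
    by (intro nn_integral_eq_integral integrable_divide_zero integrable_inverse_log2_SNR)
      (auto elim!: eventually_mono)
  finally show ?thesis
    unfolding integral_divide_zero expectation_inverse_log2_SNR .
qed

section \<open>Total upload time as a sum of products over devices\<close>

text \<open>Once the value of \<open>K\<close> is fixed, the sum and the quantifier range over fixed
  finite sets. This form serves both measurability and the expansion into products.\<close>

lemma total_upload_time_eq_sum:
  "total_upload_time Bo K U \<gamma> C u \<omega> =
    (\<Sum>k<K \<omega>. if U k \<omega> \<le> u \<and> (\<forall>j\<in>{..<K \<omega>}. U j \<omega> \<le> u \<longrightarrow> j \<noteq> k \<longrightarrow> C j \<omega> \<noteq> C k \<omega>)
       then U k \<omega> / (Bo * log 2 (1 + \<gamma> k \<omega>)) else 0)"
proof -
  have "offloading K U C u \<omega> =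
      {k \<in> {..<K \<omega>}. U k \<omega> \<le> u \<and> (\<forall>j\<in>{..<K \<omega>}. U j \<omega> \<le> u \<longrightarrow> j \<noteq> k \<longrightarrow> C j \<omega> \<noteq> C k \<omega>)}"
    by (auto simp: offloading_def contending_def)
  moreover have "total_upload_time Bo K U \<gamma> C u \<omega>
      = (\<Sum>k\<in>offloading K U C u \<omega>. U k \<omega> / (Bo * log 2 (1 + \<gamma> k \<omega>)))"
    unfolding total_upload_time_def num_offloading_def upload_time_def offloading_device_def Let_def
    by (rule sum_nth_sorted_list_of_set) (simp add: calculation)
  ultimately show ?thesis by (simp only: sum.inter_filter[OF finite_lessThan])
qed

lemma measurable_total_upload_time [measurable]:
  "total_upload_time Bo K U \<gamma> C u \<in> borel_measurable P"
proof -
  have "(\<lambda>\<omega>. \<Sum>k<n. if U k \<omega> \<le> u \<and> (\<forall>j\<in>{..<n}. U j \<omega> \<le> u \<longrightarrow> j \<noteq> k \<longrightarrow> C j \<omega> \<noteq> C k \<omega>)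
      then U k \<omega> / (Bo * log 2 (1 + \<gamma> k \<omega>)) else 0) \<in> borel_measurable P" for n
  proof (intro borel_measurable_sum measurable_If borel_measurable_divide)
    fix k
    have "{\<omega> \<in> space P. real (C j \<omega>) \<noteq> real (C k \<omega>)} \<in> sets P" for j
      by (rule borel_measurable_neq) measurable
    then have [measurable]: "Measurable.pred P (\<lambda>\<omega>. C j \<omega> \<noteq> C k \<omega>)" for j
      by (simp add: pred_def)
    show "{\<omega> \<in> space P. U k \<omega> \<le> u \<and> (\<forall>j\<in>{..<n}. U j \<omega> \<le> u \<longrightarrow> j \<noteq> k \<longrightarrow> C j \<omega> \<noteq> C k \<omega>)} \<in> sets P"
      by measurable
  qed measurable
  \<comment> \<open>\<open>K\<close> takes countably many values, so measurability for each fixed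
    \<open>n\<close> suffices.\<close>
  then show ?thesis
    unfolding total_upload_time_eq_sum[abs_def]
    by (rule measurable_compose_countable[OF _ measurable_K])
qed

text \<open>
  The product of these factors over \<open>j < n\<close> is the upload time of device \<open>k\<close> if it uploads and
  chooses channel \<open>c\<close>, and 0 otherwise.
\<close>

definition device_factor :: "real \<Rightarrow> real \<Rightarrow> nat \<Rightarrow> nat \<Rightarrow> nat \<Rightarrow> real \<Rightarrow> real \<Rightarrow> real \<Rightarrow> ennreal" where
  "device_factor Bo u k c j x y z =
    (if j = k then ennreal x * indicator {..u} x * ennreal (1 / (Bo * log 2 (1 + y))) * indicator {real c} z
     else if x \<le> u \<and> z = real c then 0 else 1)"

lemma measurable_device_factor [measurable]:
  "(\<lambda>(x, y, z). device_factor Bo u k c j x y z) \<in> borel_measurable (borel \<Otimes>\<^sub>M borel \<Otimes>\<^sub>M borel)"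
  unfolding device_factor_def by measurable

lemma measurable_device_factor' [measurable]:
  "(\<lambda>\<omega>. device_factor Bo u k c j (U j \<omega>) (\<gamma> j \<omega>) (real (C j \<omega>))) \<in> borel_measurable P"
  unfolding device_factor_def by measurable

text \<open>Only \<open>c = C k \<omega>\<close> contributes, and \<open>C k \<omega> < M\<close>
  puts it in the range of the sum. Fixing \<open>c\<close> replaces the comparison of
  \<open>C j\<close> with \<open>C k\<close>, which couples two devices, by comparisons of each
  device with a constant; the factors then become independent.\<close>

lemma sum_prod_device_factor:
  assumes "k < n" "C k \<omega> < M" "0 \<le> U k \<omega>"
  shows "(\<Sum>c<M. \<Prod>j<n. device_factor Bo u k c j (U j \<omega>) (\<gamma> j \<omega>) (real (C j \<omega>))) =
    ennreal (if U k \<omega> \<le> u \<and> (\<forall>j\<in>{..<n}. U j \<omega> \<le> u \<longrightarrow> j \<noteq> k \<longrightarrow> C j \<omega> \<noteq> C k \<omega>)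
       then U k \<omega> / (Bo * log 2 (1 + \<gamma> k \<omega>)) else 0)" (is "(\<Sum>c<M. \<Prod>j<n. ?d c j) = ?r")
proof -
  have others: "(\<Prod>j\<in>{..<n} - {k}. ?d c j) =
      (if \<forall>j\<in>{..<n}. U j \<omega> \<le> u \<longrightarrow> j \<noteq> k \<longrightarrow> C j \<omega> \<noteq> c then 1 else 0)" for c
  proof (cases "\<forall>j\<in>{..<n}. U j \<omega> \<le> u \<longrightarrow> j \<noteq> k \<longrightarrow> C j \<omega> \<noteq> c")
    case True
    then have "\<forall>j\<in>{..<n} - {k}. ?d c j = 1"
      unfolding device_factor_def by auto
    then show ?thesis using True by (simp add: prod.neutral)
  next
    case False
    then obtain j where "j \<in> {..<n} - {k}" "U j \<omega> \<le> u" "C j \<omega> = c" by blast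
    then have "(\<Prod>j\<in>{..<n} - {k}. ?d c j) = 0"
      by (intro prod_zero) (auto simp: device_factor_def)
    then show ?thesis unfolding if_not_P[OF False] .
  qed
  have "(\<Prod>j<n. ?d c j) = (if c = C k \<omega> then ?r else 0)" for c
  proof -
    have "(\<Prod>j<n. ?d c j) = ?d c k * (\<Prod>j\<in>{..<n} - {k}. ?d c j)"
      using assms by (intro prod.remove) auto
    then show ?thesis
      unfolding others using assms
      by (auto simp: device_factor_def ennreal_mult'[symmetric])
  qed
  then show ?thesis using assms by simp
qed

text \<open>The indicators of \<open>K = n\<close> replace the random range of devices by a fixed
  one. The equation holds only almost everywhere because valid channels, nonnegative sizes and
  positive SNRs are almost sure properties.\<close>

lemma AE_total_upload_time:
  assumes "0 < Bo" "1 \<le> M"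
  shows "AE \<omega> in P. ennreal (total_upload_time Bo K U \<gamma> C u \<omega>) =
    (\<Sum>n. \<Sum>k<n. \<Sum>c<M. indicator {real n} (real (K \<omega>)) *
       (\<Prod>j<n. device_factor Bo u k c j (U j \<omega>) (\<gamma> j \<omega>) (real (C j \<omega>))))"
proof -
  have "AE \<omega> in P. \<forall>k. C k \<omega> < M \<and> 0 \<le> U k \<omega> \<and> 0 < \<gamma> k \<omega>"
    using AE_C_less[OF assms(2)] AE_U_nonneg \<gamma>_pos by (simp add: AE_all_countable)
  then show ?thesis
  proof eventually_elim
    fix \<omega> assume *: "\<forall>k. C k \<omega> < M \<and> 0 \<le> U k \<omega> \<and> 0 < \<gamma> k \<omega>"
    have nonneg: "0 \<le> U k \<omega> / (Bo * log 2 (1 + \<gamma> k \<omega>))" for k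
      using *[rule_format, of k] assms by (intro divide_nonneg_nonneg mult_nonneg_nonneg) auto
    let ?d = "\<lambda>n k c. \<Prod>j<n. device_factor Bo u k c j (U j \<omega>) (\<gamma> j \<omega>) (real (C j \<omega>))"
    \<comment> \<open>Only the term with \<open>n = K \<omega>\<close> is nonzero.\<close>
    have "(\<Sum>n. \<Sum>k<n. \<Sum>c<M. indicator {real n} (real (K \<omega>)) * ?d n k c) =
      (\<Sum>n\<in>{K \<omega>}. \<Sum>k<n. \<Sum>c<M. indicator {real n} (real (K \<omega>)) * ?d n k c)"
      by (rule suminf_finite) auto
    also have "\<dots> = (\<Sum>k<K \<omega>. \<Sum>c<M. ?d (K \<omega>) k c)" by simp
    also have "\<dots> = (\<Sum>k<K \<omega>. ennreal (if U k \<omega> \<le> u \<and>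
        (\<forall>j\<in>{..<K \<omega>}. U j \<omega> \<le> u \<longrightarrow> j \<noteq> k \<longrightarrow> C j \<omega> \<noteq> C k \<omega>)
       then U k \<omega> / (Bo * log 2 (1 + \<gamma> k \<omega>)) else 0))"
      using * by (intro sum.cong sum_prod_device_factor) auto
    also have "\<dots> = ennreal (total_upload_time Bo K U \<gamma> C u \<omega>)"
      unfolding total_upload_time_eq_sum
      using nonneg by (intro sum_ennreal) (simp split: if_splits)
    finally show "ennreal (total_upload_time Bo K U \<gamma> C u \<omega>) =
        (\<Sum>n. \<Sum>k<n. \<Sum>c<M. indicator {real n} (real (K \<omega>)) * ?d n k c)" ..
  qed
qed

section \<open>The mean of the total upload time\<close>

text \<open>This factor is 1 minus the indicator that device \<open>j\<close> contends on channel
  \<open>c\<close>. Unlike the factor, that indicator is a product over size and channel, so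
  independence gives its mean.\<close>

lemma nn_integral_device_factor_other:
  assumes "0 < \<mu>" "0 \<le> u" "c < M" "j \<noteq> k"
  shows "(\<integral>\<^sup>+\<omega>. device_factor Bo u k c j (U j \<omega>) (\<gamma> j \<omega>) (real (C j \<omega>)) \<partial>P)
    = ennreal (1 - (1 - exp (- \<mu> * u)) / real M)"
proof -
  let ?d = "\<lambda>\<omega>. device_factor Bo u k c j (U j \<omega>) (\<gamma> j \<omega>) (real (C j \<omega>))"
  let ?e = "\<lambda>\<omega>. indicator {..u} (U j \<omega>) * 1 * indicator {real c} (real (C j \<omega>)) :: ennreal"
  have "(\<integral>\<^sup>+\<omega>. ?e \<omega> \<partial>P) = (\<integral>\<^sup>+\<omega>. indicator {..u} (U j \<omega>) \<partial>P) * (\<integral>\<^sup>+\<omega>. 1 \<partial>P)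
      * (\<integral>\<^sup>+\<omega>. indicator {real c} (real (C j \<omega>)) \<partial>P)"
    by (rule nn_integral_device) auto
  also have "\<dots> = ennreal ((1 - exp (- \<mu> * u)) / real M)"
    using assms by (simp add: nn_integral_U_le nn_integral_indicator_C emeasure_space_1 ennreal_mult'[symmetric] del: mult_minus_left)
  finally have e: "(\<integral>\<^sup>+\<omega>. ?e \<omega> \<partial>P) = ennreal ((1 - exp (- \<mu> * u)) / real M)" .
  \<comment> \<open>Only nonnegative functions are added; the finite mean of \<open>?e\<close> is
    cancelled afterwards.\<close>
  have "(\<integral>\<^sup>+\<omega>. ?d \<omega> \<partial>P) + (\<integral>\<^sup>+\<omega>. ?e \<omega> \<partial>P) = (\<integral>\<^sup>+\<omega>. ?d \<omega> + ?e \<omega> \<partial>P)"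
    by (intro nn_integral_add[symmetric]) measurable
  also have "\<dots> = (\<integral>\<^sup>+\<omega>. 1 \<partial>P)"
    using assms by (intro nn_integral_cong) (auto simp: device_factor_def split: split_indicator)
  also have "\<dots> = 1" by (simp add: emeasure_space_1)
  finally have "(\<integral>\<^sup>+\<omega>. ?d \<omega> \<partial>P) = 1 - ennreal ((1 - exp (- \<mu> * u)) / real M)"
    unfolding e using ennreal_add_diff_cancel_right[of "ennreal ((1 - exp (- \<mu> * u)) / real M)" "\<integral>\<^sup>+\<omega>. ?d \<omega> \<partial>P"]
    by simp
  then show ?thesis
    using assms by (simp add: ennreal_minus flip: ennreal_1)
qed

lemma nn_integral_device_factor_self:
  assumes "0 < \<mu>" "0 < u" "c < M" "0 < Bo"
  shows "(\<integral>\<^sup>+\<omega>. device_factor Bo u k c k (U k \<omega>) (\<gamma> k \<omega>) (real (C k \<omega>)) \<partial>P)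
    = ennreal (truncated_mean \<mu> u * ((\<integral>x. 1 / log 2 (1 + x) \<partial>\<Gamma>) / Bo) * (1 / real M))"
proof -
  have "(\<integral>\<^sup>+\<omega>. device_factor Bo u k c k (U k \<omega>) (\<gamma> k \<omega>) (real (C k \<omega>)) \<partial>P)
    = (\<integral>\<^sup>+\<omega>. ennreal (U k \<omega>) * indicator {..u} (U k \<omega>) \<partial>P)
      * (\<integral>\<^sup>+\<omega>. ennreal (1 / (Bo * log 2 (1 + \<gamma> k \<omega>))) \<partial>P)
      * (\<integral>\<^sup>+\<omega>. indicator {real c} (real (C k \<omega>)) \<partial>P)"
    unfolding device_factor_def if_True simp_thms
    by (rule nn_integral_device) measurable
  also have "\<dots> = ennreal (truncated_mean \<mu> u) * ennreal ((\<integral>x. 1 / log 2 (1 + x) \<partial>\<Gamma>) / Bo) * ennreal (1 / real M)"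
    using assms by (simp add: nn_integral_truncated_U nn_integral_inverse_rate nn_integral_indicator_C)
  also have "\<dots> = ennreal (truncated_mean \<mu> u * ((\<integral>x. 1 / log 2 (1 + x) \<partial>\<Gamma>) / Bo) * (1 / real M))"
    using assms truncated_mean_pos[of \<mu> u] expectation_inverse_log2_SNR_pos
    by (intro ennreal_mult3) simp_all
  finally show ?thesis .
qed

text \<open>For given \<open>n\<close> every pair of a device \<open>k\<close> and a channel
  \<open>c\<close> contributes the same amount. The \<open>M\<close> channels cancel the probability
  \<open>1 / M\<close> of the chosen one, the \<open>n\<close> devices give the factor
  \<open>n\<close>, and the size-biased Poisson series sums the rest.\<close>

lemma nn_integral_total_upload_time:
  assumes "0 < lam" "0 < \<mu>" "0 < u" "0 < Bo" "1 \<le> M"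
  shows "(\<integral>\<^sup>+\<omega>. ennreal (total_upload_time Bo K U \<gamma> C u \<omega>) \<partial>P)
    = ennreal (lam * exp (- lam * ((1 - exp (- \<mu> * u)) / real M)) *
        (truncated_mean \<mu> u * ((\<integral>x. 1 / log 2 (1 + x) \<partial>\<Gamma>) / Bo)))"
proof -
  \<comment> \<open>\<open>r\<close> is the probability that a device does not contend on a given
    channel, \<open>a\<close> the mean upload time of a device with collisions ignored and
    non-contending devices counted as 0, and \<open>p n\<close> the probability of
    \<open>K = n\<close>.\<close>
  define r where "r = 1 - (1 - exp (- \<mu> * u)) / real M"
  define a where "a = truncated_mean \<mu> u * ((\<integral>x. 1 / log 2 (1 + x) \<partial>\<Gamma>) / Bo)"
  define p where "p n = lam ^ n / fact n * exp (- lam)" for n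
  have a: "0 \<le> a"
    unfolding a_def using assms truncated_mean_pos[of \<mu> u] expectation_inverse_log2_SNR_pos by simp
  have "(1 - exp (- \<mu> * u)) / real M \<le> 1 / 1"
    using assms by (intro frac_le) auto
  then have r: "0 \<le> r" by (simp add: r_def)
  have p: "0 \<le> p n" for n unfolding p_def using assms by simp
  have factor: "(\<integral>\<^sup>+\<omega>. indicator {real n} (real (K \<omega>)) *
      (\<Prod>j<n. device_factor Bo u k c j (U j \<omega>) (\<gamma> j \<omega>) (real (C j \<omega>))) \<partial>P)
      = ennreal (p n * (a / real M * r ^ (n - 1)))" if "k < n" "c < M" for n k c
  proof -
    have "(\<integral>\<^sup>+\<omega>. indicator {real n} (real (K \<omega>)) *
        (\<Prod>j<n. device_factor Bo u k c j (U j \<omega>) (\<gamma> j \<omega>) (real (C j \<omega>))) \<partial>P)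
      = (\<integral>\<^sup>+\<omega>. indicator {real n} (real (K \<omega>)) \<partial>P) *
        (\<Prod>j<n. \<integral>\<^sup>+\<omega>. device_factor Bo u k c j (U j \<omega>) (\<gamma> j \<omega>) (real (C j \<omega>)) \<partial>P)"
      by (rule nn_integral_prod_devices) measurable
    also have "\<dots> = ennreal (p n) * (\<Prod>j<n. if j = k then ennreal (a / real M) else ennreal r)"
      unfolding nn_integral_indicator_K[OF assms(1)] p_def r_def a_def using assms that
      by (intro arg_cong2[where f="(*)"] prod.cong refl)
        (simp add: nn_integral_device_factor_self nn_integral_device_factor_other)
    also have "(\<Prod>j<n. if j = k then ennreal (a / real M) else ennreal r)
        = ennreal (a / real M) * ennreal r ^ (n - 1)"
      using that by (subst prod.remove[of _ k]) auto
    also have "ennreal (p n) * (ennreal (a / real M) * ennreal r ^ (n - 1))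
        = ennreal (p n * (a / real M) * r ^ (n - 1))"
      unfolding ennreal_power[OF r] mult.assoc[symmetric] using a p by (intro ennreal_mult3) auto
    finally show ?thesis by (simp only: mult.assoc)
  qed
  have "(\<integral>\<^sup>+\<omega>. ennreal (total_upload_time Bo K U \<gamma> C u \<omega>) \<partial>P)
    = (\<integral>\<^sup>+\<omega>. (\<Sum>n. \<Sum>k<n. \<Sum>c<M. indicator {real n} (real (K \<omega>)) *
       (\<Prod>j<n. device_factor Bo u k c j (U j \<omega>) (\<gamma> j \<omega>) (real (C j \<omega>)))) \<partial>P)"
    by (rule nn_integral_cong_AE[OF AE_total_upload_time[OF assms(4,5)]])
  \<comment> \<open>All terms are nonnegative, so the integral passes through the series and both
    sums.\<close>
  also have "\<dots> = (\<Sum>n. \<Sum>k<n. \<Sum>c<M. \<integral>\<^sup>+\<omega>. indicator {real n} (real (K \<omega>)) *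
       (\<Prod>j<n. device_factor Bo u k c j (U j \<omega>) (\<gamma> j \<omega>) (real (C j \<omega>))) \<partial>P)"
    by (subst nn_integral_suminf, measurable)
      (intro suminf_cong, subst nn_integral_sum, measurable,
        intro sum.cong refl, subst nn_integral_sum, measurable)
  also have "\<dots> = (\<Sum>n. \<Sum>k<n. \<Sum>c<M. ennreal (p n * (a / real M * r ^ (n - 1))))"
    using factor by (intro suminf_cong sum.cong refl) auto
  also have "\<dots> = (\<Sum>n. ennreal (p n * (real n * r ^ (n - 1)) * a))"
  proof (rule suminf_cong)
    fix n
    have "0 \<le> p n * (a / real M * r ^ (n - 1))" using a r p by simp
    then have "(\<Sum>k<n. \<Sum>c<M. ennreal (p n * (a / real M * r ^ (n - 1))))
        = ennreal (\<Sum>k<n. \<Sum>c<M. p n * (a / real M * r ^ (n - 1)))"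
      by (simp only: sum_ennreal sum_nonneg)
    \<comment> \<open>At \<open>n = 0\<close>, where \<open>n - 1\<close> is cut off to 0, both
      sides are 0.\<close>
    also have "(\<Sum>k<n. \<Sum>c<M. p n * (a / real M * r ^ (n - 1))) = p n * (real n * r ^ (n - 1)) * a"
      using assms by simp
    finally show "(\<Sum>k<n. \<Sum>c<M. ennreal (p n * (a / real M * r ^ (n - 1))))
        = ennreal (p n * (real n * r ^ (n - 1)) * a)" .
  qed
  also have "\<dots> = ennreal (lam * exp (- lam * (1 - r)) * a)"
  proof (rule suminf_ennreal_eq)
    show "0 \<le> p n * (real n * r ^ (n - 1)) * a" for n using a r p by simp
    show "(\<lambda>n. p n * (real n * r ^ (n - 1)) * a) sums (lam * exp (- lam * (1 - r)) * a)"
      unfolding p_def by (intro sums_mult2 sums_poisson_size_biased)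
  qed
  finally show ?thesis by (simp add: r_def a_def)
qed

text \<open>Nonnegativity almost everywhere lets the expectation be read off from the nonnegative
  integral, whose finiteness gives integrability.\<close>

lemma total_upload_time_moment:
  assumes "0 < lam" "0 < \<mu>" "0 < u" "0 < Bo" "1 \<le> M"
  shows integrable_total_upload_time: "integrable P (total_upload_time Bo K U \<gamma> C u)"
    and expectation_total_upload_time: "expectation (total_upload_time Bo K U \<gamma> C u) =
      lam * exp (- lam * ((1 - exp (- \<mu> * u)) / real M)) *
        (truncated_mean \<mu> u * ((\<integral>x. 1 / log 2 (1 + x) \<partial>\<Gamma>) / Bo))"
proof -
  have "AE \<omega> in P. \<forall>k. 0 \<le> U k \<omega> \<and> 0 < \<gamma> k \<omega>"
    using AE_U_nonneg \<gamma>_pos by (simp add: AE_all_countable)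
  then have nonneg: "AE \<omega> in P. 0 \<le> total_upload_time Bo K U \<gamma> C u \<omega>"
  proof eventually_elim
    fix \<omega> assume *: "\<forall>k. 0 \<le> U k \<omega> \<and> 0 < \<gamma> k \<omega>"
    have "0 \<le> U k \<omega> / (Bo * log 2 (1 + \<gamma> k \<omega>))" for k
      using *[rule_format, of k] assms by (intro divide_nonneg_nonneg mult_nonneg_nonneg) auto
    then show "0 \<le> total_upload_time Bo K U \<gamma> C u \<omega>"
      unfolding total_upload_time_eq_sum by (intro sum_nonneg) (simp split: if_splits)
  qed
  note nn = nn_integral_total_upload_time[OF assms]
  show "integrable P (total_upload_time Bo K U \<gamma> C u)"
    by (rule integrableI_nn_integral_finite[OF _ nonneg nn]) measurable
  show "expectation (total_upload_time Bo K U \<gamma> C u) =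
      lam * exp (- lam * ((1 - exp (- \<mu> * u)) / real M)) *
        (truncated_mean \<mu> u * ((\<integral>x. 1 / log 2 (1 + x) \<partial>\<Gamma>) / Bo))"
    using assms truncated_mean_pos[of \<mu> u] expectation_inverse_log2_SNR_pos
    by (subst integral_eq_nn_integral[OF _ nonneg]) (simp_all add: nn)
qed

end

section \<open>Monotonicity in the number of channels and in the threshold\<close>

text \<open>The probability space and all variables may change with \<open>M\<close> and
  \<open>Umax\<close>; only the parameters and \<open>\<Gamma>\<close> are shared, so the comparison
  goes through the closed formula rather than a coupling. Integrability is asserted as well because
  the expectation of a non-integrable function is 0 by convention.\<close>

theorem lemma2:
  fixes lam \<mu> b B :: real
    and \<Gamma> :: "real measure"
    and P :: "nat \<Rightarrow> real \<Rightarrow> 'a measure"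
    and K :: "nat \<Rightarrow> real \<Rightarrow> 'a \<Rightarrow> nat"
    and U \<gamma> :: "nat \<Rightarrow> real \<Rightarrow> nat \<Rightarrow> 'a \<Rightarrow> real"
    and C :: "nat \<Rightarrow> real \<Rightarrow> nat \<Rightarrow> 'a \<Rightarrow> nat"
  defines "D \<equiv> \<lambda>M Umax. total_upload_time (B - real M * b)
                 (K M Umax) (U M Umax) (\<gamma> M Umax) (C M Umax) Umax"
  assumes "0 < lam" "0 < \<mu>" "0 < b" "0 < B"
    and model: "\<And>M Umax. 1 \<le> M \<Longrightarrow> real M * b < B \<Longrightarrow> 0 < Umax \<Longrightarrow>
      one_round_model (P M Umax) lam \<mu> \<Gamma> M (K M Umax) (U M Umax) (\<gamma> M Umax) (C M Umax)"
  shows "(\<forall>M Umax. 1 \<le> M \<longrightarrow> real M * b < B \<longrightarrow> 0 < Umax \<longrightarrow>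
            integrable (P M Umax) (D M Umax))
       \<and> (\<forall>Umax > 0. strict_mono_on {M. 1 \<le> M \<and> real M * b < B}
            (\<lambda>M. prob_space.expectation (P M Umax) (D M Umax)))
       \<and> (\<forall>M. 1 \<le> M \<longrightarrow> real M * b < B \<longrightarrow> lam \<le> real M \<longrightarrow>
            strict_mono_on {0<..} (\<lambda>Umax. prob_space.expectation (P M Umax) (D M Umax)))"
proof (intro conjI allI impI)
  let ?G = "\<integral>x. 1 / log 2 (1 + x) \<partial>\<Gamma>"
  have D: "integrable (P M u) (D M u) \<and> prob_space.expectation (P M u) (D M u) =
      lam * exp (- lam * ((1 - exp (- \<mu> * u)) / real M)) *
        (truncated_mean \<mu> u * (?G / (B - real M * b)))"
    and G: "0 < ?G" if "1 \<le> M" "real M * b < B" "0 < u" for M u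
  proof -
    interpret one_round_model "P M u" lam \<mu> \<Gamma> M "K M u" "U M u" "\<gamma> M u" "C M u"
      by (rule model[OF that])
    show "integrable (P M u) (D M u) \<and> expectation (D M u) =
      lam * exp (- lam * ((1 - exp (- \<mu> * u)) / real M)) *
        (truncated_mean \<mu> u * (?G / (B - real M * b)))"
      unfolding D_def using integrable_total_upload_time expectation_total_upload_time that assms(2,3)
      by simp
    show "0 < ?G" by (rule expectation_inverse_log2_SNR_pos)
  qed
  show "integrable (P M u) (D M u)" if "1 \<le> M" "real M * b < B" "0 < u" for M u
    using D[OF that] by blast
  show "strict_mono_on {M. 1 \<le> M \<and> real M * b < B} (\<lambda>M. prob_space.expectation (P M u) (D M u))"
    if u: "0 < u" for u
  proof (rule strict_mono_onI)
    fix M N :: nat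
    assume M: "M \<in> {M. 1 \<le> M \<and> real M * b < B}" and N: "N \<in> {M. 1 \<le> M \<and> real M * b < B}"
      and "M < N"
    have MN: "real M * b < real N * b" using \<open>M < N\<close> \<open>0 < b\<close> by simp
    have "(1 - exp (- \<mu> * u)) / real N \<le> (1 - exp (- \<mu> * u)) / real M"
      using M \<open>M < N\<close> \<open>0 < \<mu>\<close> u by (intro divide_left_mono) auto
    then have "exp (- lam * ((1 - exp (- \<mu> * u)) / real M)) \<le> exp (- lam * ((1 - exp (- \<mu> * u)) / real N))"
      using \<open>0 < lam\<close> by (simp only: exp_le_cancel_iff mult_minus_left neg_le_iff_le mult_le_cancel_left_pos)
    \<comment> \<open>Strictness is taken from this factor: as \<open>0 < b\<close>, more channels
      leave less bandwidth for offloading.\<close>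
    moreover have "?G / (B - real M * b) < ?G / (B - real N * b)"
      using M N MN G[of M u] u by (intro divide_strict_left_mono) auto
    moreover have "0 < ?G / (B - real M * b)" using G[of M u] M u by simp
    moreover from this have "0 \<le> truncated_mean \<mu> u * (?G / (B - real M * b))"
      using truncated_mean_pos[OF \<open>0 < \<mu>\<close> u] by (intro mult_nonneg_nonneg) simp_all
    ultimately have "lam * exp (- lam * ((1 - exp (- \<mu> * u)) / real M)) *
        (truncated_mean \<mu> u * (?G / (B - real M * b)))
      < lam * exp (- lam * ((1 - exp (- \<mu> * u)) / real N)) *
        (truncated_mean \<mu> u * (?G / (B - real N * b)))"
      using truncated_mean_pos[OF \<open>0 < \<mu>\<close> u] \<open>0 < lam\<close>
      by (intro mult_le_less_imp_less mult_strict_left_mono mult_left_mono mult_pos_pos) simp_all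
    then show "prob_space.expectation (P M u) (D M u) < prob_space.expectation (P N u) (D N u)"
      using D[of M u] D[of N u] M N u by (simp only: mem_Collect_eq)
  qed
  show "strict_mono_on {0<..} (\<lambda>u. prob_space.expectation (P M u) (D M u))"
    if M: "1 \<le> M" "real M * b < B" and "lam \<le> real M" for M
  proof (rule strict_mono_onI)
    fix u v :: real
    assume "u \<in> {0<..}" "v \<in> {0<..}" and "u < v"
    then have u: "0 < u" and v: "0 < v" by auto
    have "0 < lam * (?G / (B - real M * b))" using G[OF M u] \<open>0 < lam\<close> M by simp
    \<comment> \<open>The hypothesis \<open>lam \<le> real M\<close> enters here, as
      \<open>c \<le> 1\<close> for \<open>c = lam / real M\<close>.\<close>
    moreover have "truncated_mean \<mu> u * exp (- (lam / real M) * (1 - exp (- \<mu> * u)))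
        < truncated_mean \<mu> v * exp (- (lam / real M) * (1 - exp (- \<mu> * v)))"
      using \<open>0 < lam\<close> \<open>lam \<le> real M\<close> \<open>1 \<le> M\<close>
      by (intro truncated_mean_times_exp_less \<open>0 < \<mu>\<close> u \<open>u < v\<close>) auto
    ultimately have "lam * (?G / (B - real M * b)) * (truncated_mean \<mu> u * exp (- (lam / real M) * (1 - exp (- \<mu> * u))))
        < lam * (?G / (B - real M * b)) * (truncated_mean \<mu> v * exp (- (lam / real M) * (1 - exp (- \<mu> * v))))"
      by (rule mult_strict_left_mono[rotated])
    moreover have "prob_space.expectation (P M w) (D M w) =
        lam * (?G / (B - real M * b)) * (truncated_mean \<mu> w * exp (- (lam / real M) * (1 - exp (- \<mu> * w))))"
      if "0 < w" for w
    proof -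
      have "- lam * ((1 - exp (- \<mu> * w)) / real M) = - (lam / real M) * (1 - exp (- \<mu> * w))" by simp
      with D[OF M that] show ?thesis by (simp only: mult_ac)
    qed
    ultimately show "prob_space.expectation (P M u) (D M u) < prob_space.expectation (P M v) (D M v)"
      using u v by (simp only:)
  qed
qed

end
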